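(* Let $M\in\mathcal{K}_o^n$ and let $f:S^{n-1}\rightarrow\mathbb{R}$ be continuous. If $Q\in\mathcal{S}_o^n$, $j\neq n$ and $q\neq0$, then $$\lim_{t\rightarrow0}\frac{\widetilde{W}_{q,j}([M,f,t],Q)-\widetilde{W}_{q,j}(M,Q)}{t}=q\int_{S^{n-1}}f(v)\,d\widetilde{\mathcal{C}}_{q,j}(M,Q,v).$$
   Context: $\mathcal{K}_o^n$: convex bodies in $\mathbb{R}^n$ containing the origin in their interiors; $\mathcal{S}_o^n$: compact sets star-shaped about the origin with positive continuous radial function $\rho_Q(x)=\max\{\lambda\ge0:\lambda x\in Q\}$. $h_M$ is the support function, $du$ spherical Lebesgue measure. $[M,f,t]$ denotes a logarithmic family of Wulff shapes generated by $(h_M,f)$: for some $\delta>0$ and $t\in(-\delta,\delta)$, $h_t:S^{n-1}\to(0,\infty)$ is continuous with $\log h_t=\log h_M+tf+o(t,\cdot)$, where $o(t,\cdot)$ is continuous and $o(t,\cdot)/t\to0$ uniformly on $S^{n-1}$ as $t\to0$, and $[M,f,t]=\{x\in\mathbb{R}^n:x\cdot v\le h_t(v)\ \forall v\in S^{n-1}\}$. $\widetilde{W}_{q,j}(M,Q)=\frac1n\int_{S^{n-1}}\rho_M^q\rho_Q^{n-q-j}\,du$; $R^*_M(\eta)=\{u\in S^{n-1}:\rho_M(u)u\cdot v=h_M(v)\text{ for some }v\in\eta\}$ for Borel $\eta\subseteq S^{n-1}$; $\widetilde{\mathcal{C}}_{q,j}(M,Q,\eta)=\frac1n\int_{R^*_M(\eta)}\rho_M^q(u)\rho_Q^{n-q-j}(u)\,du$.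 *)

theory Defs
  imports "HOL-Analysis.Analysis"
begin

definition support_fun :: "'a::euclidean_space set \<Rightarrow> 'a \<Rightarrow> real" where
  "support_fun M v = Sup ((\<lambda>x. x \<bullet> v) ` M)"

definition radial_fun :: "'a::euclidean_space set \<Rightarrow> 'a \<Rightarrow> real" where
  "radial_fun Q x = Sup {l. 0 \<le> l \<and> l *\<^sub>R x \<in> Q}"

definition convex_body_o :: "'a::euclidean_space set \<Rightarrow> bool" where
  "convex_body_o M \<longleftrightarrow> compact M \<and> convex M \<and> 0 \<in> interior M"

definition star_body_o :: "'a::euclidean_space set \<Rightarrow> bool" where
  "star_body_o Q \<longleftrightarrow> compact Q \<and> 0 \<in> Q \<and>
     (\<forall>x\<in>Q. \<forall>s\<in>{0..1}. s *\<^sub>R x \<in> Q) \<and>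
     (\<forall>u\<in>sphere 0 1. radial_fun Q u > 0) \<and>
     continuous_on (sphere 0 1) (radial_fun Q)"

text \<open>Spherical Lebesgue measure on S^{n-1}, defined via the cone-volume formula
  sigma(A) = n * vol { t u : u in A, 0 < t <= 1 }.\<close>
definition sphere_measure :: "'a::euclidean_space measure" where
  "sphere_measure =
     density (distr (restrict_space lborel (cball 0 1 - {0}))
                    (restrict_space borel (sphere 0 1))
                    (\<lambda>x. x /\<^sub>R norm x))
             (\<lambda>_. ennreal (real DIM('a)))"

definition wulff_shape :: "('a::euclidean_space \<Rightarrow> real) \<Rightarrow> 'a set" where
  "wulff_shape h = {x. \<forall>v\<in>sphere 0 1. x \<bullet> v \<le> h v}"

definition dual_W :: "real \<Rightarrow> real \<Rightarrow> 'a::euclidean_space set \<Rightarrow> 'a set \<Rightarrow> real" where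
  "dual_W q j M Q = (1 / real DIM('a)) *
     (\<integral>u. radial_fun M u powr q * radial_fun Q u powr (real DIM('a) - q - j) \<partial>sphere_measure)"

definition rev_radial_gauss :: "'a::euclidean_space set \<Rightarrow> 'a set \<Rightarrow> 'a set" where
  "rev_radial_gauss M \<eta> = {u \<in> sphere 0 1. \<exists>v\<in>\<eta>.
      (radial_fun M u *\<^sub>R u) \<bullet> v = support_fun M v}"

definition dual_curv_measure :: "real \<Rightarrow> real \<Rightarrow> 'a::euclidean_space set \<Rightarrow> 'a set \<Rightarrow> 'a measure" where
  "dual_curv_measure q j M Q =
     measure_of (sphere 0 1) (sets (restrict_space borel (sphere 0 1)))
       (\<lambda>\<eta>. \<integral>\<^sup>+ u. indicator (rev_radial_gauss M \<eta>) u *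
               ennreal ((1 / real DIM('a)) * radial_fun M u powr q *
                        radial_fun Q u powr (real DIM('a) - q - j)) \<partial>sphere_measure)"

end

theory Submission
  imports Defs
begin

text \<open>A Wulff shape has radial function \<open>\<rho>\<^sub>t(u) = min h\<^sub>t(v) / (u \<bullet> v)\<close>, the minimum being over the
  unit vectors \<open>v\<close> with \<open>u \<bullet> v > 0\<close>, so \<open>ln \<rho>\<^sub>t(u)\<close> is a minimum of functions whose
  \<open>t\<close>-derivative at 0 is \<open>f\<close>. Hence \<open>ln \<rho>\<^sub>t(u)\<close> is Lipschitz in \<open>t\<close> at 0, uniformly in \<open>u\<close>, and by
  Danskin's envelope argument its derivative is \<open>f(v)\<close> wherever the minimizer \<open>v\<close> for \<open>t = 0\<close> is
  unique. Minimizers are the subgradients, up to scaling, of the gauge of \<open>M\<close>, a monotone relation,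
  so they are unique almost everywhere. Dominated convergence gives the derivative, and the dual
  curvature measure is the image of \<open>\<rho>\<^sub>M powr q * \<rho>\<^sub>Q powr (n - q - j) du / n\<close> under the almost everywhere defined map
  from \<open>u\<close> to its minimizer.\<close>

section \<open>Monotone relations are single-valued almost everywhere\<close>

text \<open>For a monotone relation the map from \<open>x + w\<close> to \<open>x\<close> is 1-Lipschitz, and it is constant on
  \<open>x\<close> plus the convex set of values at \<open>x\<close>. If there are two values, this set crosses a
  hyperplane \<open>i \<bullet> y = r\<close> with \<open>i\<close> a basis vector and \<open>r\<close> rational, so \<open>x\<close> lies in one
  of countably many Lipschitz images of negligible sets.\<close>

lemma negligible_multivalued_monotone:
  fixes R :: "'a::euclidean_space \<Rightarrow> 'a \<Rightarrow> bool"
  assumes mono: "\<And>x w x' w'. R x w \<Longrightarrow> R x' w' \<Longrightarrow> 0 \<le> (x - x') \<bullet> (w - w')"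
    and conv: "\<And>x. convex {w. R x w}"
  shows "negligible {x. \<exists>w w'. w \<noteq> w' \<and> R x w \<and> R x w'}"
proof -
  define A where "A i r = {y. (\<exists>x w. R x w \<and> y = x + w) \<and> i \<bullet> y = r}" for i :: 'a and r :: real
  \<comment> \<open>\<open>P\<close> recovers \<open>x\<close> from a sum \<open>x + w\<close>. The
    contraction estimate \<open>lip\<close> makes this \<open>x\<close> unique, so the choice
    operator only names it.\<close>
  define P where "P y = (SOME x. \<exists>w. R x w \<and> y = x + w)" for y
  have lip: "norm (x - x') \<le> norm (x + w - (x' + w'))" if "R x w" "R x' w'" for x w x' w'
  proof -
    have "norm (x - x')^2 \<le> (x - x') \<bullet> (x - x') + (x - x') \<bullet> (w - w')"
      using mono[OF that] by (simp add: power2_norm_eq_inner)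
    also have "\<dots> = (x - x') \<bullet> (x + w - (x' + w'))"
      by (simp add: algebra_simps)
    also have "\<dots> \<le> norm (x - x') * norm (x + w - (x' + w'))"
      by (rule norm_cauchy_schwarz)
    finally have *: "norm (x - x') * norm (x - x') \<le> norm (x - x') * norm (x + w - (x' + w'))"
      by (simp add: power2_eq_square)
    show ?thesis
    proof (cases "x = x'")
      case False
      then show ?thesis using * by (simp add: mult_le_cancel_left)
    qed simp
  qed
  have P_sum: "\<exists>w. R (P y) w \<and> y = P y + w" if "y \<in> A i r" for y i r
    using that unfolding P_def A_def by (intro someI_ex[of "\<lambda>x. \<exists>w. R x w \<and> y = x + w"]) auto
  have P_eq: "P (x + w) = x" if xw: "R x w" and xA: "x + w \<in> A i r" for x w i r
  proof -
    obtain w' where w': "R (P (x + w)) w'" "x + w = P (x + w) + w'" using P_sum[OF xA] by blast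
    have "norm (x - P (x + w)) \<le> norm (x + w - (P (x + w) + w'))" by (rule lip[OF xw w'(1)])
    then show ?thesis unfolding w'(2)[symmetric] by simp
  qed
  have neg: "negligible (P ` A i r)" if "i \<in> Basis" for i r
  proof (rule negligible_locally_Lipschitz_image)
    have "negligible {y. i \<bullet> y = r}" using that by (intro negligible_hyperplane) auto
    then show "negligible (A i r)" by (rule negligible_subset) (auto simp: A_def)
    fix y assume y: "y \<in> A i r"
    have "norm (P z - P y) \<le> 1 * norm (z - y)" if z: "z \<in> A i r" for z
    proof -
      obtain v where v: "R (P y) v" "y = P y + v" using P_sum[OF y] by blast
      obtain w where w: "R (P z) w" "z = P z + w" using P_sum[OF z] by blast
      show ?thesis using lip[OF w(1) v(1)] unfolding v(2)[symmetric] w(2)[symmetric] by simp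
    qed
    then show "\<exists>T B. open T \<and> y \<in> T \<and> (\<forall>z\<in>A i r \<inter> T. norm (P z - P y) \<le> B * norm (z - y))"
      by (intro exI[of _ UNIV] exI[of _ 1]) auto
  qed simp
  have "{x. \<exists>w w'. w \<noteq> w' \<and> R x w \<and> R x w'} \<subseteq> (\<Union>i\<in>Basis. \<Union>r\<in>\<rat>. P ` A i r)"
  proof
    fix x assume "x \<in> {x. \<exists>w w'. w \<noteq> w' \<and> R x w \<and> R x w'}"
    then obtain a b where "a \<noteq> b" "R x a" "R x b" by blast
    then obtain i where i: "i \<in> Basis" "a \<bullet> i \<noteq> b \<bullet> i" by (metis euclidean_eqI)
    have "\<exists>w w'. R x w \<and> R x w' \<and> (x + w) \<bullet> i < (x + w') \<bullet> i"
    proof (cases "a \<bullet> i < b \<bullet> i")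
      case True
      then show ?thesis using \<open>R x a\<close> \<open>R x b\<close> by (intro exI[of _ a] exI[of _ b]) (simp add: inner_add_left)
    next
      case False
      then show ?thesis using i(2) \<open>R x a\<close> \<open>R x b\<close>
        by (intro exI[of _ b] exI[of _ a]) (simp add: inner_add_left)
    qed
    then obtain w w' where w: "R x w" "R x w'" "(x + w) \<bullet> i < (x + w') \<bullet> i" by blast
    obtain r where r: "r \<in> \<rat>" "(x + w) \<bullet> i < r" "r < (x + w') \<bullet> i"
      using Rats_dense_in_real[OF w(3)] by blast
    \<comment> \<open>The parameter at which the segment from \<open>x + w\<close> to
      \<open>x + w'\<close> crosses the hyperplane at height \<open>r\<close>; by convexity the
      corresponding value \<open>z\<close> is still related to \<open>x\<close>.\<close>
    define l where "l = (r - (x + w) \<bullet> i) / (w' \<bullet> i - w \<bullet> i)"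
    have d: "w' \<bullet> i - w \<bullet> i > 0" using w(3) by (simp add: inner_add_left)
    have l: "0 \<le> l" "l \<le> 1" using r d by (auto simp: l_def inner_add_left field_simps)
    define z where "z = (1 - l) *\<^sub>R w + l *\<^sub>R w'"
    have "R x z" using conv[of x] w l unfolding convex_alt z_def by blast
    moreover have "i \<bullet> (x + z) = (x + w) \<bullet> i + l * (w' \<bullet> i - w \<bullet> i)"
      by (simp add: z_def inner_commute algebra_simps)
    then have "i \<bullet> (x + z) = r" using d by (simp add: l_def)
    ultimately have xz: "x + z \<in> A i r" unfolding A_def by blast
    then have "x \<in> P ` A i r" using P_eq[OF \<open>R x z\<close> xz] by (metis imageI)
    then show "x \<in> (\<Union>i\<in>Basis. \<Union>r\<in>\<rat>. P ` A i r)" using i(1) r(1) by blast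
  qed
  moreover have "negligible (\<Union>i\<in>Basis. \<Union>r\<in>\<rat>. P ` A i r)"
  proof (rule negligible_Union)
    show "negligible T" if T: "T \<in> (\<lambda>i. \<Union>r\<in>\<rat>. P ` A i r) ` Basis" for T
    proof -
      obtain i :: 'a where i: "i \<in> Basis" "T = (\<Union>r\<in>\<rat>. P ` A i r)" using T by blast
      show ?thesis unfolding i(2)
        by (rule negligible_countable_Union) (use neg[OF i(1)] countable_rat in auto)
    qed
  qed simp
  ultimately show ?thesis using negligible_subset by blast
qed

section \<open>Radial functions of Wulff shapes and support functions of convex bodies\<close>

text \<open>The constraint of \<open>v\<close> at \<open>l *\<^sub>R u\<close> reads
  \<open>l * ((u \<bullet> v) / h v) \<le> 1\<close>. If \<open>G\<close> is the largest ratio on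
  the compact sphere, the admissible scalars fill \<open>{0..1 / G}\<close>, so the radial function
  is \<open>1 / G\<close> and the maximizer \<open>w\<close> is an active constraint.\<close>

lemma wulff_radial:
  fixes h :: "'a::euclidean_space \<Rightarrow> real"
  assumes cont: "continuous_on (sphere 0 1) h" and pos: "\<forall>v\<in>sphere 0 1. h v > 0"
    and u: "u \<in> sphere 0 1"
  shows "radial_fun (wulff_shape h) u > 0" (is "?r > 0")
    and "v \<in> sphere 0 1 \<Longrightarrow> radial_fun (wulff_shape h) u * (u \<bullet> v) \<le> h v"
    and "\<exists>v\<in>sphere 0 1. radial_fun (wulff_shape h) u * (u \<bullet> v) = h v"
proof -
  have "continuous_on (sphere 0 1) (\<lambda>v. (u \<bullet> v) / h v)"
    using pos by (intro continuous_on_divide continuous_intros cont) force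
  then obtain w where w: "w \<in> sphere 0 1" "\<And>v. v \<in> sphere 0 1 \<Longrightarrow> (u \<bullet> v) / h v \<le> (u \<bullet> w) / h w"
    using continuous_attains_sup[of "sphere 0 1" "\<lambda>v. (u \<bullet> v) / h v"] u by fastforce
  define G where "G = (u \<bullet> w) / h w"
  \<comment> \<open>The competitor \<open>v = u\<close> gives \<open>G \<ge> 1 / h u\<close>, which
    makes \<open>G\<close> positive and the ray bounded.\<close>
  have "(u \<bullet> u) / h u \<le> G" using w(2)[OF u] by (simp add: G_def)
  moreover have "u \<bullet> u = 1" using u by (simp add: dot_square_norm)
  ultimately have G: "G > 0" using pos u by (metis bspec divide_pos_pos less_le_trans zero_less_one)
  have le: "l * (u \<bullet> v) \<le> h v" if "0 \<le> l" "l \<le> 1 / G" "v \<in> sphere 0 1" for l v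
  proof -
    have "l * ((u \<bullet> v) / h v) \<le> l * G" using w(2)[OF that(3)] that(1) by (intro mult_left_mono) (auto simp: G_def)
    also have "\<dots> \<le> 1" using that(2) G by (simp add: field_simps)
    finally show ?thesis using pos that(3) by (auto simp: pos_divide_le_eq)
  qed
  have "{l. 0 \<le> l \<and> l *\<^sub>R u \<in> wulff_shape h} = {0..1 / G}"
  proof (intro set_eqI iffI)
    fix l assume l: "l \<in> {l. 0 \<le> l \<and> l *\<^sub>R u \<in> wulff_shape h}"
    then have "l * (u \<bullet> w) \<le> h w" using w(1) by (auto simp: wulff_shape_def)
    then have "l * G \<le> 1" using bspec[OF pos w(1)] by (simp add: G_def)
    then show "l \<in> {0..1 / G}" using l G by (simp add: field_simps)
  next
    fix l assume "l \<in> {0..1 / G}"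
    then show "l \<in> {l. 0 \<le> l \<and> l *\<^sub>R u \<in> wulff_shape h}" using le by (auto simp: wulff_shape_def)
  qed
  then have r: "?r = 1 / G" unfolding radial_fun_def using G by simp
  show "?r > 0" using r G by simp
  show "?r * (u \<bullet> v) \<le> h v" if "v \<in> sphere 0 1" using le[of ?r v] that r G by simp
  have "u \<bullet> w = G * h w" using bspec[OF pos w(1)] by (simp add: G_def)
  then have "?r * (u \<bullet> w) = h w" using r G by simp
  then show "\<exists>v\<in>sphere 0 1. ?r * (u \<bullet> v) = h v" using w(1) by blast
qed

text \<open>The reciprocal of the radial function is the gauge, a maximum of the linear functions
  \<open>(x \<bullet> v) / h v\<close>. Their slopes are at most \<open>1 / h z\<close> with
  \<open>h z\<close> the minimum of \<open>h\<close>, so the gauge is Lipschitz on the sphere, and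
  inverting it preserves continuity.\<close>

lemma continuous_on_wulff_radial:
  fixes h :: "'a::euclidean_space \<Rightarrow> real"
  assumes cont: "continuous_on (sphere 0 1) h" and pos: "\<forall>v\<in>sphere 0 1. h v > 0"
  shows "continuous_on (sphere 0 1) (radial_fun (wulff_shape h))"
proof -
  obtain e :: 'a where e: "norm e = 1" using vector_choose_size[of 1] by auto
  obtain z where z: "z \<in> sphere 0 1" "\<And>v. v \<in> sphere 0 1 \<Longrightarrow> h z \<le> h v"
    using continuous_attains_inf[OF compact_sphere _ cont] e by (metis mem_sphere_0 empty_iff)
  let ?r = "radial_fun (wulff_shape h)"
  have le: "1 / ?r x \<le> 1 / ?r y + (1 / h z) * norm (x - y)"
    if x: "x \<in> sphere 0 1" and y: "y \<in> sphere 0 1" for x y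
  proof -
    obtain v where v: "v \<in> sphere 0 1" "?r x * (x \<bullet> v) = h v"
      using wulff_radial(3)[OF cont pos x] by blast
    have rx: "?r x > 0" and ry: "?r y > 0" using wulff_radial(1)[OF cont pos] x y by blast+
    have hv: "h v > 0" using pos v(1) by blast
    have "1 / ?r x = (x \<bullet> v) / h v" using v(2) rx hv by (simp add: frac_eq_eq mult.commute)
    also have "\<dots> = (y \<bullet> v) / h v + ((x - y) \<bullet> v) / h v" by (simp add: inner_diff_left diff_divide_distrib)
    also have "\<dots> \<le> 1 / ?r y + norm (x - y) / h z"
    proof (rule add_mono)
      show "(y \<bullet> v) / h v \<le> 1 / ?r y"
        using wulff_radial(2)[OF cont pos y v(1)] hv ry by (simp add: field_simps)
      have "(x - y) \<bullet> v \<le> norm (x - y)" using norm_cauchy_schwarz[of "x - y" v] v(1) by simp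
      then show "((x - y) \<bullet> v) / h v \<le> norm (x - y) / h z"
        using z(2)[OF v(1)] bspec[OF pos z(1)] hv by (intro frac_le) auto
    qed
    finally show ?thesis by simp
  qed
  have "(1 / h z)-lipschitz_on (sphere 0 1) (\<lambda>x. 1 / ?r x)"
  proof (rule lipschitz_onI)
    show "dist (1 / ?r x) (1 / ?r y) \<le> 1 / h z * dist x y" if "x \<in> sphere 0 1" "y \<in> sphere 0 1" for x y
      using le[OF that] le[OF that(2) that(1)] by (simp add: dist_norm norm_minus_commute abs_le_iff)
    show "0 \<le> 1 / h z" using bspec[OF pos z(1)] by simp
  qed
  then have "continuous_on (sphere 0 1) (\<lambda>x. 1 / ?r x)" by (rule lipschitz_on_continuous_on)
  moreover have "\<forall>x\<in>sphere 0 1. 1 / ?r x \<noteq> 0" using wulff_radial(1)[OF cont pos] by fastforce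
  ultimately have "continuous_on (sphere 0 1) (\<lambda>x. 1 / (1 / ?r x))"
    by (rule continuous_on_divide[OF continuous_on_const])
  then show ?thesis by simp
qed

text \<open>These facts let \<open>M\<close> itself be treated as the Wulff shape at
  \<open>t = 0\<close>. The last one is strict separation: a point outside \<open>M\<close> violates
  the constraint of a suitable unit normal.\<close>

lemma support_fun_properties:
  fixes M :: "'a::euclidean_space set"
  assumes M: "convex_body_o M"
  shows support_fun_pos: "v \<in> sphere 0 1 \<Longrightarrow> support_fun M v > 0"
    and continuous_on_support_fun: "continuous_on S (support_fun M)"
    and wulff_shape_support_fun: "wulff_shape (support_fun M) = M"
proof -
  have cpt: "compact M" and cvx: "convex M" and int: "0 \<in> interior M"
    using M by (auto simp: convex_body_o_def)
  have zero: "0 \<in> M" using int interior_subset by blast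
  have attained: "\<exists>x\<in>M. x \<bullet> v = support_fun M v \<and> (\<forall>y\<in>M. y \<bullet> v \<le> x \<bullet> v)" for v
  proof -
    have "continuous_on M (\<lambda>x. x \<bullet> v)" by (intro continuous_intros)
    then obtain x where "x \<in> M" "\<forall>y\<in>M. y \<bullet> v \<le> x \<bullet> v"
      using continuous_attains_sup[OF cpt] zero by blast
    then show ?thesis unfolding support_fun_def
      by (intro bexI[of _ x]) (auto intro!: cSup_eq_maximum[symmetric])
  qed
  have upper: "x \<bullet> v \<le> support_fun M v" if "x \<in> M" for x v using attained[of v] that by fastforce
  show "support_fun M v > 0" if v: "v \<in> sphere 0 1" for v
  proof -
    obtain r where r: "r > 0" "ball 0 r \<subseteq> M" using int mem_interior by blast
    \<comment> \<open>Half the radius, because the ball is open.\<close>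
    have "(r / 2) *\<^sub>R v \<in> M" using r v by (intro subsetD[OF r(2)]) auto
    from upper[OF this, of v] have "(r / 2) * (v \<bullet> v) \<le> support_fun M v" by simp
    moreover have "v \<bullet> v = 1" using v by (simp add: dot_square_norm)
    ultimately show ?thesis using r(1) by auto
  qed
  obtain B where B: "B > 0" "\<And>x. x \<in> M \<Longrightarrow> norm x \<le> B"
    using compact_imp_bounded[OF cpt] bounded_pos by blast
  have le: "support_fun M v \<le> support_fun M w + B * norm (v - w)" for v w
  proof -
    obtain x where x: "x \<in> M" "x \<bullet> v = support_fun M v" using attained by blast
    have "support_fun M v = x \<bullet> w + x \<bullet> (v - w)" using x(2) by (simp add: inner_diff_right)
    also have "x \<bullet> (v - w) \<le> norm x * norm (v - w)" by (rule norm_cauchy_schwarz)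
    also have "\<dots> \<le> B * norm (v - w)" by (intro mult_right_mono B x) auto
    finally show ?thesis using upper[OF x(1), of w] by linarith
  qed
  have "B-lipschitz_on S (support_fun M)"
  proof (rule lipschitz_onI)
    show "dist (support_fun M x) (support_fun M y) \<le> B * dist x y" for x y
      using le[of x y] le[of y x] by (simp add: dist_norm norm_minus_commute abs_le_iff)
  qed (use B in simp)
  then show "continuous_on S (support_fun M)" by (rule lipschitz_on_continuous_on)
  show "wulff_shape (support_fun M) = M"
  proof (intro equalityI subsetI)
    show "x \<in> wulff_shape (support_fun M)" if "x \<in> M" for x
      using upper[OF that] by (simp add: wulff_shape_def)
    fix x assume x: "x \<in> wulff_shape (support_fun M)"
    show "x \<in> M"
    proof (rule ccontr)
      assume "x \<notin> M"
      then obtain a b where ab: "a \<bullet> x < b" "\<And>y. y \<in> M \<Longrightarrow> b < a \<bullet> y"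
        using separating_hyperplane_closed_point[OF cvx compact_imp_closed[OF cpt]] by blast
      have a: "a \<noteq> 0" using ab(1) ab(2)[OF zero] by auto
      \<comment> \<open>The separating functional is larger on \<open>M\<close> than at
        \<open>x\<close>, hence the sign: an outer normal points from \<open>M\<close> towards
        \<open>x\<close>.\<close>
      define v where "v = - (a /\<^sub>R norm a)"
      have v: "v \<in> sphere 0 1" using a by (simp add: v_def)
      obtain y where y: "y \<in> M" "y \<bullet> v = support_fun M v" using attained by blast
      have "x \<bullet> v \<le> y \<bullet> v" using x v y(2) by (simp add: wulff_shape_def)
      then have "a \<bullet> y \<le> a \<bullet> x" using a by (simp add: v_def inner_commute field_simps)
      then show False using ab(1) ab(2)[OF y(1)] by linarith
    qed
  qed
qed

section \<open>Active normals in a direction and their uniqueness almost everywhere\<close>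

text \<open>The minimizers of \<open>h v / (u \<bullet> v)\<close> over unit \<open>v\<close> with
  \<open>u \<bullet> v > 0\<close>, when \<open>h\<close> is positive and continuous. For a support
  function they are the outer unit normals at the boundary point in direction
  \<open>u\<close>.\<close>

definition wulff_normals :: "('a::euclidean_space \<Rightarrow> real) \<Rightarrow> 'a \<Rightarrow> 'a set" where
  "wulff_normals h u = {v \<in> sphere 0 1. radial_fun (wulff_shape h) u * (u \<bullet> v) = h v}"

definition regular_dirs :: "('a::euclidean_space \<Rightarrow> real) \<Rightarrow> 'a set" where
  "regular_dirs h = {u \<in> sphere 0 1. \<exists>v. wulff_normals h u = {v}}"

text \<open>One fixed unit vector serves for all singular directions: the map stays total with
  values in the sphere, and it is constant where normals are not unique, which keeps it
  measurable.\<close>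

definition radial_gauss_map :: "('a::euclidean_space \<Rightarrow> real) \<Rightarrow> 'a \<Rightarrow> 'a" where
  "radial_gauss_map h u = (if u \<in> regular_dirs h then the_elem (wulff_normals h u) else SOME v. norm v = 1)"

lemma wulff_normals_gauss:
  assumes "u \<in> regular_dirs h"
  shows "wulff_normals h u = {radial_gauss_map h u}"
proof -
  obtain v where "wulff_normals h u = {v}" using assms by (auto simp: regular_dirs_def)
  then show ?thesis using assms by (simp add: radial_gauss_map_def)
qed

lemma radial_gauss_map_in_sphere: "radial_gauss_map h u \<in> sphere 0 1"
proof (cases "u \<in> regular_dirs h")
  case True
  then show ?thesis using wulff_normals_gauss[OF True] by (auto simp: wulff_normals_def)
next
  case False
  obtain e :: 'a where "norm e = 1" by (rule vector_choose_size[of 1]) auto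
  then have "norm (SOME v :: 'a. norm v = 1) = 1" by (rule someI)
  then show ?thesis using False by (simp add: radial_gauss_map_def)
qed

text \<open>\<open>R x w\<close> says that \<open>w\<close> is a subgradient at \<open>x\<close> of
  the gauge \<open>g\<close>: it lies in the polar of the shape and attains \<open>g x\<close>.
  Subgradients form a monotone relation with convex values, and two normals at \<open>u\<close>
  yield two subgradients on the whole open ray through \<open>u\<close>. The cone is used instead of
  its trace on the sphere because the null set result concerns the ambient space.\<close>

lemma negligible_singular_cone:
  fixes h :: "'a::euclidean_space \<Rightarrow> real"
  assumes cont: "continuous_on (sphere 0 1) h" and pos: "\<forall>v\<in>sphere 0 1. h v > 0"
  shows "negligible {x. x \<noteq> 0 \<and> x /\<^sub>R norm x \<notin> regular_dirs h}"
proof -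
  let ?r = "radial_fun (wulff_shape h)"
  define g where "g x = norm x / ?r (x /\<^sub>R norm x)" for x
  define R where "R x w \<longleftrightarrow> x \<noteq> 0 \<and> (\<forall>z\<in>wulff_shape h. z \<bullet> w \<le> 1) \<and> x \<bullet> w = g x" for x w
  have le: "x \<bullet> w \<le> g x" if "x \<noteq> 0" and w: "\<forall>z\<in>wulff_shape h. z \<bullet> w \<le> 1" for x w
  proof -
    define u where "u = x /\<^sub>R norm x"
    have u: "u \<in> sphere 0 1" "x = norm x *\<^sub>R u" using \<open>x \<noteq> 0\<close> by (auto simp: u_def)
    have r: "?r u > 0" by (rule wulff_radial(1)[OF cont pos u(1)])
    have "?r u *\<^sub>R u \<in> wulff_shape h"
      using wulff_radial(2)[OF cont pos u(1)] by (auto simp: wulff_shape_def)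
    then have "?r u * (u \<bullet> w) \<le> 1" using w by fastforce
    then have "norm x * (?r u * (u \<bullet> w)) \<le> norm x * 1" by (intro mult_left_mono) auto
    then have "(norm x * (u \<bullet> w)) * ?r u \<le> norm x" by (simp add: mult_ac)
    then have "norm x * (u \<bullet> w) \<le> norm x / ?r u" using r by (simp add: pos_le_divide_eq)
    moreover have "x \<bullet> w = norm x * (u \<bullet> w)" by (subst u(2)) simp
    ultimately show ?thesis unfolding g_def u_def[symmetric] by linarith
  qed
  have "negligible {x. \<exists>w w'. w \<noteq> w' \<and> R x w \<and> R x w'}"
  proof (rule negligible_multivalued_monotone)
    show "0 \<le> (x - x') \<bullet> (w - w')" if "R x w" "R x' w'" for x w x' w'
    proof -
      have "x \<bullet> w' \<le> x \<bullet> w" "x' \<bullet> w \<le> x' \<bullet> w'"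
        using that le[of x w'] le[of x' w] unfolding R_def by metis+
      then show ?thesis by (simp add: inner_diff_left inner_diff_right)
    qed
    show "convex {w. R x w}" for x
    proof (rule convexI)
      fix a b and s t :: real
      assume a: "a \<in> {w. R x w}" and b: "b \<in> {w. R x w}" and st: "0 \<le> s" "0 \<le> t" "s + t = 1"
      have "z \<bullet> (s *\<^sub>R a + t *\<^sub>R b) \<le> 1" if "z \<in> wulff_shape h" for z
        using convex_bound_le[of "z \<bullet> a" 1 "z \<bullet> b" s t] a b st that
        by (auto simp: R_def inner_add_right)
      moreover have "x \<bullet> (s *\<^sub>R a + t *\<^sub>R b) = (s + t) * g x"
        using a b by (simp add: R_def inner_add_right distrib_right)
      ultimately show "s *\<^sub>R a + t *\<^sub>R b \<in> {w. R x w}" using a st by (simp add: R_def)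
    qed
  qed
  moreover have "{x. x \<noteq> 0 \<and> x /\<^sub>R norm x \<notin> regular_dirs h} \<subseteq> {x. \<exists>w w'. w \<noteq> w' \<and> R x w \<and> R x w'}"
  proof
    fix x assume "x \<in> {x. x \<noteq> 0 \<and> x /\<^sub>R norm x \<notin> regular_dirs h}"
    then have x: "x \<noteq> 0" "x /\<^sub>R norm x \<notin> regular_dirs h" by auto
    define u where "u = x /\<^sub>R norm x"
    have u: "u \<in> sphere 0 1" "x = norm x *\<^sub>R u" using x by (auto simp: u_def)
    have r: "?r u > 0" by (rule wulff_radial(1)[OF cont pos u(1)])
    obtain v where v: "v \<in> wulff_normals h u"
      using wulff_radial(3)[OF cont pos u(1)] by (auto simp: wulff_normals_def)
    obtain v' where v': "v' \<in> wulff_normals h u" "v' \<noteq> v"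
      using x(2) u(1) v unfolding regular_dirs_def u_def[symmetric] by blast
    have Rx: "R x (a /\<^sub>R h a)" if a: "a \<in> wulff_normals h u" for a
    proof -
      have ha: "h a > 0" "a \<in> sphere 0 1" "?r u * (u \<bullet> a) = h a"
        using a pos by (auto simp: wulff_normals_def)
      have "z \<bullet> (a /\<^sub>R h a) \<le> 1" if "z \<in> wulff_shape h" for z
        using that ha by (auto simp: wulff_shape_def field_simps)
      moreover have "x \<bullet> (a /\<^sub>R h a) = norm x * ((u \<bullet> a) / h a)"
        by (subst u(2)) (simp add: divide_inverse)
      moreover have "(u \<bullet> a) / h a = 1 / ?r u" using ha r by (simp add: frac_eq_eq mult.commute)
      ultimately show ?thesis using x(1) unfolding R_def g_def u_def[symmetric] by simp
    qed
    \<comment> \<open>Scaling keeps distinct normals apart: the norms of the scaled vectors are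
      \<open>1 / h v\<close> and \<open>1 / h v'\<close>, so equality would give
      \<open>h v = h v'\<close> and then \<open>v = v'\<close>.\<close>
    have "v /\<^sub>R h v \<noteq> v' /\<^sub>R h v'"
    proof
      assume eq: "v /\<^sub>R h v = v' /\<^sub>R h v'"
      have hv: "h v > 0" "h v' > 0" "norm v = 1" "norm v' = 1"
        using v v' pos by (auto simp: wulff_normals_def)
      have "norm (v /\<^sub>R h v) = norm (v' /\<^sub>R h v')" using eq by simp
      then have "h v = h v'" using hv by simp
      then show False using eq hv v'(2) by simp
    qed
    then show "x \<in> {x. \<exists>w w'. w \<noteq> w' \<and> R x w \<and> R x w'}" using Rx[OF v] Rx[OF v'(1)] by blast
  qed
  ultimately show ?thesis using negligible_subset by blast
qed

section \<open>Borel measurability of the radial Gauss map\<close>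

text \<open>The pairs of a direction and an active normal in \<open>C\<close> form a compact set,
  being the zeros of a continuous slack function on a compact product; the set in question is its
  projection.\<close>

lemma compact_reverse_wulff_image:
  fixes h :: "'a::euclidean_space \<Rightarrow> real"
  assumes cont: "continuous_on (sphere 0 1) h" and pos: "\<forall>v\<in>sphere 0 1. h v > 0" and C: "closed C"
  shows "compact {u \<in> sphere 0 1. wulff_normals h u \<inter> C \<noteq> {}}"
proof -
  let ?r = "radial_fun (wulff_shape h)" and ?S = "sphere (0::'a) 1"
  let ?K = "?S \<times> (?S \<inter> C)"
  have K: "compact ?K" using C by (intro compact_Times compact_Int_closed) auto
  have "continuous_on ?K (\<lambda>p. ?r (fst p) * (fst p \<bullet> snd p) - h (snd p))"
    by (intro continuous_intros continuous_on_compose2[OF continuous_on_wulff_radial[OF cont pos]]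
        continuous_on_compose2[OF cont]) auto
  then have "closed (?K \<inter> (\<lambda>p. ?r (fst p) * (fst p \<bullet> snd p) - h (snd p)) -` {0})"
    by (intro continuous_closed_preimage compact_imp_closed[OF K]) auto
  then have "compact (?K \<inter> (?K \<inter> (\<lambda>p. ?r (fst p) * (fst p \<bullet> snd p) - h (snd p)) -` {0}))"
    by (intro compact_Int_closed[OF K])
  then have "compact (fst ` (?K \<inter> (?K \<inter> (\<lambda>p. ?r (fst p) * (fst p \<bullet> snd p) - h (snd p)) -` {0})))"
    by (intro compact_continuous_image continuous_intros)
  also have "fst ` (?K \<inter> (?K \<inter> (\<lambda>p. ?r (fst p) * (fst p \<bullet> snd p) - h (snd p)) -` {0}))
      = {u \<in> ?S. wulff_normals h u \<inter> C \<noteq> {}}"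
    unfolding wulff_normals_def by (force simp: image_iff)
  finally show ?thesis .
qed

text \<open>The singular directions are a countable union of the compact sets \<open>B n\<close>,
  where two normals at distance at least \<open>1 / real (Suc n)\<close> exist.\<close>

lemma regular_dirs_borel:
  fixes h :: "'a::euclidean_space \<Rightarrow> real"
  assumes cont: "continuous_on (sphere 0 1) h" and pos: "\<forall>v\<in>sphere 0 1. h v > 0"
  shows "regular_dirs h \<in> sets borel"
proof -
  let ?r = "radial_fun (wulff_shape h)" and ?S = "sphere (0::'a) 1"
  let ?K = "?S \<times> ?S \<times> ?S"
  \<comment> \<open>The slacks of two candidate normals at one direction, and the distance between
    the candidates; \<open>B n\<close> projects the triples where both slacks vanish and the
    distance is not small.\<close>
  define F where "F p = (?r (fst p) * (fst p \<bullet> fst (snd p)) - h (fst (snd p)),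
     ?r (fst p) * (fst p \<bullet> snd (snd p)) - h (snd (snd p)), dist (fst (snd p)) (snd (snd p)))" for p
  define B where "B n = fst ` (?K \<inter> F -` ({0} \<times> {0} \<times> {1 / real (Suc n)..}))" for n
  have K: "compact ?K" by (intro compact_Times) auto
  have F: "continuous_on ?K F" unfolding F_def
    by (intro continuous_intros continuous_on_compose2[OF continuous_on_wulff_radial[OF cont pos]]
        continuous_on_compose2[OF cont]) auto
  have "compact (B n)" for n
  proof -
    have "closed (?K \<inter> F -` ({0} \<times> {0} \<times> {1 / real (Suc n)..}))"
      by (intro continuous_closed_preimage F compact_imp_closed[OF K] closed_Times) auto
    then have "compact (?K \<inter> (?K \<inter> F -` ({0} \<times> {0} \<times> {1 / real (Suc n)..})))"
      by (intro compact_Int_closed[OF K])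
    then show ?thesis unfolding B_def
      by (intro compact_continuous_image continuous_intros) simp
  qed
  then have B: "B n \<in> sets borel" for n by (intro borel_compact)
  have memB: "u \<in> B n \<longleftrightarrow> u \<in> ?S \<and> (\<exists>v\<in>wulff_normals h u. \<exists>w\<in>wulff_normals h u. 1 / real (Suc n) \<le> dist v w)" for u n
    unfolding B_def F_def wulff_normals_def by (force simp: image_iff)
  have "regular_dirs h = ?S - (\<Union>n. B n)"
  proof (intro equalityI subsetI)
    fix u assume u: "u \<in> regular_dirs h"
    then have "u \<notin> B n" for n unfolding memB wulff_normals_gauss[OF u] by auto
    then show "u \<in> ?S - (\<Union>n. B n)" using u by (auto simp: regular_dirs_def)
  next
    fix u assume u: "u \<in> ?S - (\<Union>n. B n)"
    obtain v where v: "v \<in> wulff_normals h u"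
      using wulff_radial(3)[OF cont pos, of u] u by (auto simp: wulff_normals_def)
    have "w = v" if w: "w \<in> wulff_normals h u" for w
    proof (rule ccontr)
      assume "w \<noteq> v"
      then have "0 < dist v w" by auto
      then obtain n where "1 / real (Suc n) < dist v w" using nat_approx_posE by blast
      then have "u \<in> B n" using u v w unfolding memB by (meson DiffD1 less_imp_le)
      then show False using u by blast
    qed
    then have "wulff_normals h u = {v}" using v by blast
    then show "u \<in> regular_dirs h" using u by (auto simp: regular_dirs_def)
  qed
  moreover have "?S \<in> sets borel" by (intro borel_closed) auto
  ultimately show ?thesis using B by auto
qed

text \<open>Closed sets generate the Borel sets, and on regular directions the preimage of a closed
  set is the compact set found above.\<close>

lemma radial_gauss_map_measurable:
  fixes h :: "'a::euclidean_space \<Rightarrow> real"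
  assumes cont: "continuous_on (sphere 0 1) h" and pos: "\<forall>v\<in>sphere 0 1. h v > 0"
  shows "radial_gauss_map h \<in> restrict_space borel (sphere 0 1) \<rightarrow>\<^sub>M restrict_space borel (sphere 0 1)"
proof (rule measurable_restrict_space2)
  let ?S = "sphere (0::'a) 1" and ?e = "SOME v::'a. norm v = 1"
  show "radial_gauss_map h \<in> space (restrict_space borel ?S) \<rightarrow> ?S"
    using radial_gauss_map_in_sphere by blast
  have S: "?S \<in> sets borel" by (intro borel_closed) auto
  have reg: "regular_dirs h \<in> sets borel" by (rule regular_dirs_borel[OF cont pos])
  have "radial_gauss_map h \<in> restrict_space borel ?S \<rightarrow>\<^sub>M sigma UNIV (Collect closed)"
  proof (rule measurable_measure_of)
    fix C :: "'a set" assume "C \<in> Collect closed"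
    then have C: "{u \<in> ?S. wulff_normals h u \<inter> C \<noteq> {}} \<in> sets borel"
      using compact_reverse_wulff_image[OF cont pos] by (intro borel_compact) auto
    \<comment> \<open>Singular directions are all sent to \<open>?e\<close>, so they enter the
      preimage together or not at all.\<close>
    have "radial_gauss_map h -` C \<inter> ?S = (regular_dirs h \<inter> {u \<in> ?S. wulff_normals h u \<inter> C \<noteq> {}})
        \<union> (if ?e \<in> C then ?S - regular_dirs h else {})"
      (is "?L = ?R")
    proof (intro set_eqI)
      fix u
      show "u \<in> ?L \<longleftrightarrow> u \<in> ?R"
      proof (cases "u \<in> regular_dirs h")
        case True
        then have "u \<in> ?S" by (simp add: regular_dirs_def)
        then show ?thesis using True wulff_normals_gauss[OF True] by auto
      next
        case False
        then show ?thesis by (auto simp: radial_gauss_map_def)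
      qed
    qed
    also have "\<dots> \<in> sets borel" using C reg S by auto
    finally show "radial_gauss_map h -` C \<inter> space (restrict_space borel ?S) \<in> sets (restrict_space borel ?S)"
      using S by (simp add: sets_restrict_space_iff space_restrict_space)
  qed auto
  then show "radial_gauss_map h \<in> borel_measurable (restrict_space borel ?S)"
    by (simp add: borel_eq_closed)
qed

section \<open>Spherical measure and the dual curvature measure as an image measure\<close>

lemma space_sphere_measure [simp]: "space (sphere_measure :: 'a::euclidean_space measure) = sphere 0 1"
  by (simp add: sphere_measure_def space_restrict_space)

lemma sets_sphere_measure [simp, measurable_cong]:
  "sets (sphere_measure :: 'a::euclidean_space measure) = sets (restrict_space borel (sphere 0 1))"
  by (simp add: sphere_measure_def)

lemma radial_projection_measurable:
  "(\<lambda>x::'a::euclidean_space. x /\<^sub>R norm x) \<in> restrict_space lborel (cball 0 1 - {0}) \<rightarrow>\<^sub>M restrict_space borel (sphere 0 1)"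
proof (rule measurable_restrict_space2)
  show "(\<lambda>x::'a. x /\<^sub>R norm x) \<in> space (restrict_space lborel (cball 0 1 - {0})) \<rightarrow> sphere 0 1"
    by (simp add: space_restrict_space)
  have "(\<lambda>x::'a. x /\<^sub>R norm x) \<in> borel_measurable lborel" by measurable
  then show "(\<lambda>x::'a. x /\<^sub>R norm x) \<in> borel_measurable (restrict_space lborel (cball 0 1 - {0}))"
    by (rule measurable_restrict_space1)
qed

lemma finite_sphere_measure: "finite_measure (sphere_measure :: 'a::euclidean_space measure)"
proof (rule finite_measureI)
  let ?N = "restrict_space lborel (cball 0 1 - {0 :: 'a})"
  let ?D = "distr ?N (restrict_space borel (sphere 0 1)) (\<lambda>x. x /\<^sub>R norm x)"
  have S: "sphere 0 1 \<in> sets (restrict_space borel (sphere (0 :: 'a) 1))"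
    using sets.top[of "restrict_space borel (sphere (0 :: 'a) 1)"] unfolding space_restrict_space by (simp del: sets.top)
  have "emeasure (sphere_measure :: 'a measure) (sphere 0 1) = ennreal (real DIM('a)) * emeasure ?D (space ?D)"
    unfolding sphere_measure_def
    by (subst emeasure_density; (subst nn_integral_cmult_indicator)?) (simp_all add: space_restrict_space S)
  moreover have "emeasure ?D (space ?D) = emeasure ?N (space ?N)"
    by (subst emeasure_distr[OF radial_projection_measurable])
       (auto intro!: arg_cong[of _ _ "emeasure ?N"] simp: space_restrict_space S)
  moreover have "emeasure ?N (space ?N) \<le> emeasure lborel (cball 0 1 :: 'a set)"
    by (auto simp: space_restrict_space emeasure_restrict_space intro!: emeasure_mono)
  moreover have "emeasure lborel (cball 0 1 :: 'a set) < \<infinity>" by (intro emeasure_compact_finite) auto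
  ultimately show "emeasure (sphere_measure :: 'a measure) (space sphere_measure) \<noteq> \<infinity>"
    by (simp add: ennreal_mult_eq_top_iff top.not_eq_extremum)
qed

text \<open>Spherical measure is a multiple of the radial projection of volume on the punctured
  ball, so a Borel set of directions is null as soon as the cone over it is.\<close>

lemma AE_sphere_measure_regular:
  fixes h :: "'a::euclidean_space \<Rightarrow> real"
  assumes cont: "continuous_on (sphere 0 1) h" and pos: "\<forall>v\<in>sphere 0 1. h v > 0"
  shows "AE u in sphere_measure. u \<in> regular_dirs h"
proof -
  let ?N = "restrict_space lborel (cball 0 1 - {0 :: 'a})"
  let ?D = "distr ?N (restrict_space borel (sphere 0 1)) (\<lambda>x. x /\<^sub>R norm x)"
  have "AE x in lebesgue. x \<notin> {x. x \<noteq> 0 \<and> x /\<^sub>R norm x \<notin> regular_dirs h}"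
    by (intro AE_not_in) (use negligible_singular_cone[OF cont pos] in \<open>simp add: negligible_iff_null_sets\<close>)
  then have "AE x in lborel. x \<in> cball 0 1 - {0} \<longrightarrow> x /\<^sub>R norm x \<in> regular_dirs h"
    unfolding AE_completion_iff by eventually_elim auto
  then have "AE x in ?N. x /\<^sub>R norm x \<in> regular_dirs h"
    by (subst AE_restrict_space_iff) auto
  moreover have "{u \<in> space (restrict_space borel (sphere 0 1)). u \<in> regular_dirs h} \<in> sets (restrict_space borel (sphere 0 1))"
    using regular_dirs_borel[OF cont pos] by (auto simp: sets_restrict_space space_restrict_space)
  ultimately have "AE u in ?D. u \<in> regular_dirs h"
    by (subst AE_distr_iff[OF radial_projection_measurable]) auto
  then show ?thesis unfolding sphere_measure_def by (subst AE_density) auto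
qed

text \<open>At a regular \<open>u\<close> the only normal is the Gauss image, so \<open>u\<close>
  lies in the reverse image of \<open>\<eta>\<close> exactly when that image lies in
  \<open>\<eta>\<close>. This turns integrals against the dual curvature measure into integrals over
  directions.\<close>

lemma dual_curv_measure_eq_distr:
  fixes M Q :: "'a::euclidean_space set" and q j :: real
  assumes M: "convex_body_o M" and Q: "star_body_o Q"
  defines "w \<equiv> \<lambda>u. (1 / real DIM('a)) * radial_fun M u powr q * radial_fun Q u powr (real DIM('a) - q - j)"
  shows "dual_curv_measure q j M Q =
    distr (density sphere_measure (\<lambda>u. ennreal (w u))) (restrict_space borel (sphere 0 1))
      (radial_gauss_map (support_fun M))" (is "_ = ?D")
    and "w \<in> borel_measurable sphere_measure"
proof -
  let ?S = "sphere (0::'a) 1" and ?h = "support_fun M"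
  let ?B = "restrict_space borel ?S"
  have cont: "continuous_on ?S ?h" by (rule continuous_on_support_fun[OF M])
  have pos: "\<forall>v\<in>?S. ?h v > 0" using support_fun_pos[OF M] by blast
  have W: "wulff_shape ?h = M" by (rule wulff_shape_support_fun[OF M])
  have "continuous_on ?S w" unfolding w_def
    using continuous_on_wulff_radial[OF cont pos] wulff_radial(1)[OF cont pos] Q
    by (intro continuous_intros) (auto simp: W star_body_o_def less_le)
  then show wm: "w \<in> borel_measurable sphere_measure"
    using borel_measurable_continuous_on_restrict by (simp cong: measurable_cong_sets)
  have gm: "radial_gauss_map ?h \<in> sphere_measure \<rightarrow>\<^sub>M ?B"
    using radial_gauss_map_measurable[OF cont pos] by (simp cong: measurable_cong_sets)
  have emeas: "emeasure ?D \<eta> = (\<integral>\<^sup>+ u. indicator (rev_radial_gauss M \<eta>) u * ennreal (w u) \<partial>sphere_measure)"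
    if eta: "\<eta> \<in> sets ?B" for \<eta>
  proof -
    have "radial_gauss_map ?h -` \<eta> \<inter> ?S \<in> sets sphere_measure"
      using measurable_sets[OF gm eta] by simp
    then have "emeasure ?D \<eta> = (\<integral>\<^sup>+ u. ennreal (w u) * indicator (radial_gauss_map ?h -` \<eta> \<inter> ?S) u \<partial>sphere_measure)"
      using gm wm eta by (subst emeasure_distr) (auto simp: emeasure_density)
    also have "\<dots> = (\<integral>\<^sup>+ u. indicator (rev_radial_gauss M \<eta>) u * ennreal (w u) \<partial>sphere_measure)"
    proof (rule nn_integral_cong_AE, use AE_sphere_measure_regular[OF cont pos] in eventually_elim)
      fix u assume u: "u \<in> regular_dirs ?h"
      have eS: "\<eta> \<subseteq> ?S" using eta by (auto simp: sets_restrict_space)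
      have uS: "u \<in> ?S" using u by (simp add: regular_dirs_def)
      have "u \<in> rev_radial_gauss M \<eta> \<longleftrightarrow> wulff_normals ?h u \<inter> \<eta> \<noteq> {}"
        using uS eS unfolding rev_radial_gauss_def wulff_normals_def W inner_scaleR_left by blast
      also have "\<dots> \<longleftrightarrow> radial_gauss_map ?h u \<in> \<eta>"
        using wulff_normals_gauss[OF u] by auto
      finally show "ennreal (w u) * indicator (radial_gauss_map ?h -` \<eta> \<inter> ?S) u
          = indicator (rev_radial_gauss M \<eta>) u * ennreal (w u)"
        using uS by (simp add: indicator_def)
    qed
    finally show ?thesis .
  qed
  have "dual_curv_measure q j M Q = measure_of (space ?D) (sets ?D)
       (\<lambda>\<eta>. \<integral>\<^sup>+ u. indicator (rev_radial_gauss M \<eta>) u * ennreal (w u) \<partial>sphere_measure)"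
    by (simp add: dual_curv_measure_def w_def space_restrict_space)
  \<comment> \<open>\<open>measure_of\<close> sees the set function only on the sigma-algebra, where
    it agrees with \<open>emeasure ?D\<close>; countable additivity is thereby inherited from
    \<open>?D\<close>.\<close>
  also have "\<dots> = measure_of (space ?D) (sets ?D) (emeasure ?D)"
    by (intro measure_of_eq sets.space_closed) (metis emeas sets.sigma_sets_eq sets_distr)
  also have "\<dots> = ?D" by (rule measure_of_of_measure)
  finally show "dual_curv_measure q j M Q = ?D" .
qed

section \<open>Logarithmic variation of the radial function\<close>

text \<open>The envelope inequality: \<open>v\<close> is optimal for \<open>h\<close> but merely a
  competitor for \<open>k\<close>. Exchanging \<open>h\<close> and \<open>k\<close> gives the
  opposite bound, at a normal of the other shape.\<close>

lemma ln_wulff_radial_diff_le: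
  fixes h k :: "'a::euclidean_space \<Rightarrow> real"
  assumes h: "continuous_on (sphere 0 1) h" "\<forall>v\<in>sphere 0 1. h v > 0"
    and k: "continuous_on (sphere 0 1) k" "\<forall>v\<in>sphere 0 1. k v > 0"
    and u: "u \<in> sphere 0 1" and v: "v \<in> wulff_normals h u"
  shows "ln (radial_fun (wulff_shape k) u) - ln (radial_fun (wulff_shape h) u) \<le> ln (k v) - ln (h v)"
proof -
  let ?r = "radial_fun (wulff_shape h) u" and ?s = "radial_fun (wulff_shape k) u"
  have r: "?r > 0" and s: "?s > 0" using wulff_radial(1) h k u by blast+
  have v': "v \<in> sphere 0 1" "?r * (u \<bullet> v) = h v" using v by (auto simp: wulff_normals_def)
  have hv: "h v > 0" and kv: "k v > 0" using h k v' by auto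
  have "?s * (u \<bullet> v) \<le> k v" by (rule wulff_radial(2)[OF k u v'(1)])
  then have "?r * (?s * (u \<bullet> v)) \<le> ?r * k v" using r by simp
  then have "?s * h v \<le> ?r * k v" using v'(2) by (metis mult.left_commute)
  then have "ln (?s * h v) \<le> ln (?r * k v)" using s hv by (intro ln_mono) auto
  then show ?thesis using r s hv kv by (simp add: ln_mult)
qed

lemma ln_wulff_radial_diff_bound:
  fixes h k :: "'a::euclidean_space \<Rightarrow> real"
  assumes h: "continuous_on (sphere 0 1) h" "\<forall>v\<in>sphere 0 1. h v > 0"
    and k: "continuous_on (sphere 0 1) k" "\<forall>v\<in>sphere 0 1. k v > 0"
    and u: "u \<in> sphere 0 1" and c: "\<forall>v\<in>sphere 0 1. \<bar>ln (k v) - ln (h v)\<bar> \<le> c"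
  shows "\<bar>ln (radial_fun (wulff_shape k) u) - ln (radial_fun (wulff_shape h) u)\<bar> \<le> c"
proof -
  obtain v where v: "v \<in> wulff_normals h u"
    using wulff_radial(3)[OF h u] by (auto simp: wulff_normals_def)
  obtain w where w: "w \<in> wulff_normals k u"
    using wulff_radial(3)[OF k u] by (auto simp: wulff_normals_def)
  have "v \<in> sphere 0 1" "w \<in> sphere 0 1" using v w by (auto simp: wulff_normals_def)
  then have "\<bar>ln (k v) - ln (h v)\<bar> \<le> c" "\<bar>ln (k w) - ln (h w)\<bar> \<le> c" using c by blast+
  then show ?thesis
    using ln_wulff_radial_diff_le[OF h k u v] ln_wulff_radial_diff_le[OF k h u w] by linarith
qed

text \<open>The logarithmic change at \<open>u\<close> is at most that of the bounding function at
  \<open>v0\<close> and at least that at a normal \<open>w\<close> of the perturbed shape. Both are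
  \<open>t * f\<close> up to \<open>o(t)\<close>, so it remains to bring \<open>f w\<close> close to
  \<open>f v0\<close>.\<close>

lemma tendsto_ln_wulff_radial:
  fixes h :: "'a::euclidean_space \<Rightarrow> real" and k :: "real \<Rightarrow> 'a \<Rightarrow> real"
  assumes h: "continuous_on (sphere 0 1) h" "\<forall>v\<in>sphere 0 1. h v > 0"
    and k: "\<forall>\<^sub>F t in at 0. continuous_on (sphere 0 1) (k t) \<and> (\<forall>v\<in>sphere 0 1. k t v > 0)"
    and f: "continuous_on (sphere 0 1) f"
    and lip: "\<forall>\<^sub>F t in at 0. \<forall>v\<in>sphere 0 1. \<bar>ln (k t v) - ln (h v)\<bar> \<le> C * \<bar>t\<bar>"
    and unif: "\<And>\<epsilon>. \<epsilon> > 0 \<Longrightarrow> \<forall>\<^sub>F t in at 0. \<forall>v\<in>sphere 0 1. \<bar>ln (k t v) - ln (h v) - t * f v\<bar> \<le> \<epsilon> * \<bar>t\<bar>"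
    and u: "u \<in> regular_dirs h"
  shows "((\<lambda>t. (ln (radial_fun (wulff_shape (k t)) u) - ln (radial_fun (wulff_shape h) u)) / t)
           \<longlongrightarrow> f (radial_gauss_map h u)) (at 0)"
proof (rule tendstoI)
  fix e :: real assume e: "e > 0"
  let ?S = "sphere (0::'a) 1"
  let ?r = "radial_fun (wulff_shape h) u" and ?s = "\<lambda>t. radial_fun (wulff_shape (k t)) u"
  define v0 where "v0 = radial_gauss_map h u"
  have uS: "u \<in> ?S" using u by (simp add: regular_dirs_def)
  have v0: "wulff_normals h u = {v0}" using wulff_normals_gauss[OF u] by (simp add: v0_def)
  then have v0S: "v0 \<in> ?S" by (auto simp: wulff_normals_def)
  have r: "?r > 0" by (rule wulff_radial(1)[OF h uS])
  \<comment> \<open>Bad normals are singled out by the value of \<open>f\<close>, not by their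
    distance to \<open>v0\<close>, since only \<open>f w\<close> enters the estimate.\<close>
  define K where "K = {v \<in> ?S. e / 4 \<le> \<bar>f v - f v0\<bar>}"
  have "closed (?S \<inter> (\<lambda>v. \<bar>f v - f v0\<bar>) -` {e / 4..})"
    by (intro continuous_closed_preimage continuous_intros f) auto
  then have "compact (?S \<inter> (?S \<inter> (\<lambda>v. \<bar>f v - f v0\<bar>) -` {e / 4..}))"
    by (intro compact_Int_closed) auto
  then have K: "compact K" by (rule back_subst[of compact]) (auto simp: K_def)
  \<comment> \<open>Away from v0 the constraint is slack by a factor bounded away from 1, so for small t
     no normal of the perturbed body at u can lie there.\<close>
  obtain \<theta> where \<theta>: "\<theta> < 1" "0 < \<theta>" "\<And>v. v \<in> K \<Longrightarrow> ?r * (u \<bullet> v) \<le> \<theta> * h v"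
  proof (cases "K = {}")
    case True
    then show ?thesis using that[of "1/2"] by auto
  next
    case False
    have "continuous_on K (\<lambda>v. ?r * (u \<bullet> v) / h v)"
      using h(2) by (intro continuous_on_divide continuous_intros continuous_on_subset[OF h(1)]) (auto simp: K_def less_le)
    then obtain z where z: "z \<in> K" "\<And>v. v \<in> K \<Longrightarrow> ?r * (u \<bullet> v) / h v \<le> ?r * (u \<bullet> z) / h z"
      using continuous_attains_sup[OF K False] by blast
    have zS: "z \<in> ?S" and "z \<noteq> v0" using z(1) e by (auto simp: K_def)
    then have "?r * (u \<bullet> z) \<noteq> h z" using v0 by (auto simp: wulff_normals_def)
    then have "?r * (u \<bullet> z) < h z" using wulff_radial(2)[OF h uS zS] by simp
    then have lt: "?r * (u \<bullet> z) / h z < 1" using h(2) zS by simp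
    show ?thesis
    \<comment> \<open>The maximal ratio on \<open>K\<close> may be zero or negative; the maximum
      with \<open>1/2\<close> keeps \<open>ln \<theta>\<close> meaningful.\<close>
    proof (rule that[of "max (1/2) (?r * (u \<bullet> z) / h z)"])
      fix v assume v: "v \<in> K"
      then have "h v > 0" using h(2) by (simp add: K_def)
      moreover have "?r * (u \<bullet> v) / h v \<le> max (1/2) (?r * (u \<bullet> z) / h z)" using z(2)[OF v] by simp
      ultimately show "?r * (u \<bullet> v) \<le> max (1/2) (?r * (u \<bullet> z) / h z) * h v"
        by (simp only: pos_divide_le_eq)
    qed (use lt in auto)
  qed
  \<comment> \<open>One \<open>C * \<bar>t\<bar>\<close> pays for the change of the logarithmic
    radius and one for that of the bounding function at \<open>w\<close>; together they must not use
    up the slack \<open>- ln \<theta>\<close>.\<close>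
  have "((\<lambda>t. 2 * (C * \<bar>t\<bar>)) \<longlongrightarrow> 2 * (C * \<bar>0\<bar>)) (at 0)" by (intro tendsto_intros)
  then have small: "\<forall>\<^sub>F t in at 0. 2 * (C * \<bar>t\<bar>) < - ln \<theta>"
    using \<theta> by (intro order_tendstoD) auto
  have "\<forall>\<^sub>F t in at 0. t \<noteq> (0::real)" by (simp add: eventually_at_filter)
  moreover have "\<forall>\<^sub>F t in at 0. \<forall>v\<in>?S. \<bar>ln (k t v) - ln (h v) - t * f v\<bar> \<le> e / 4 * \<bar>t\<bar>"
    using e by (intro unif) auto
  ultimately show "\<forall>\<^sub>F t in at 0. dist ((ln (?s t) - ln ?r) / t) (f (radial_gauss_map h u)) < e"
    using k lip small
  proof eventually_elim
    case (elim t)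
    have kt: "continuous_on ?S (k t)" "\<forall>v\<in>?S. k t v > 0" using elim by auto
    have s: "?s t > 0" by (rule wulff_radial(1)[OF kt uS])
    obtain w where w: "w \<in> wulff_normals (k t) u"
      using wulff_radial(3)[OF kt uS] by (auto simp: wulff_normals_def)
    have wS: "w \<in> ?S" "?s t * (u \<bullet> w) = k t w" using w by (auto simp: wulff_normals_def)
    have hw: "h w > 0" and kw: "k t w > 0" using h kt wS by auto
    have uw: "u \<bullet> w > 0" using wS(2) kw s by (metis zero_less_mult_pos)
    have "w \<notin> K"
    proof
      assume "w \<in> K"
      then have "ln (?r * (u \<bullet> w)) \<le> ln (\<theta> * h w)" using \<theta>(3) r uw by (intro ln_mono) auto
      then have 1: "ln ?r + ln (u \<bullet> w) \<le> ln \<theta> + ln (h w)" using r uw hw \<theta> by (simp add: ln_mult)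
      have 2: "ln (?s t) + ln (u \<bullet> w) = ln (k t w)" using wS(2) s uw by (metis ln_mult_pos)
      have "\<bar>ln (?s t) - ln ?r\<bar> \<le> C * \<bar>t\<bar>" using ln_wulff_radial_diff_bound[OF h kt uS] elim by blast
      moreover have "\<bar>ln (k t w) - ln (h w)\<bar> \<le> C * \<bar>t\<bar>" using elim wS by blast
      ultimately show False using 1 2 elim by linarith
    qed
    then have fw: "\<bar>f w - f v0\<bar> < e / 4" using wS by (simp add: K_def)
    have up: "ln (?s t) - ln ?r \<le> ln (k t v0) - ln (h v0)"
      using ln_wulff_radial_diff_le[OF h kt uS] v0 by blast
    have lo: "ln (k t w) - ln (h w) \<le> ln (?s t) - ln ?r"
      using ln_wulff_radial_diff_le[OF kt h uS w] by linarith
    have e1: "\<bar>ln (k t v0) - ln (h v0) - t * f v0\<bar> \<le> e / 4 * \<bar>t\<bar>" and e2: "\<bar>ln (k t w) - ln (h w) - t * f w\<bar> \<le> e / 4 * \<bar>t\<bar>"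
      using elim v0S wS by blast+
    have "\<bar>t * f w - t * f v0\<bar> = \<bar>t\<bar> * \<bar>f w - f v0\<bar>" by (simp flip: right_diff_distrib add: abs_mult)
    also have "\<dots> \<le> \<bar>t\<bar> * (e / 4)" using fw by (intro mult_left_mono) auto
    finally have e3: "\<bar>t * f w - t * f v0\<bar> \<le> e / 4 * \<bar>t\<bar>" by (simp add: mult.commute)
    \<comment> \<open>The lower bound costs one quarter for the expansion at \<open>w\<close> and
      one for replacing \<open>f w\<close> by \<open>f v0\<close>; the upper bound costs only the
      quarter at \<open>v0\<close>.\<close>
    have "\<bar>ln (?s t) - ln ?r - t * f v0\<bar> \<le> e / 4 * \<bar>t\<bar> + e / 4 * \<bar>t\<bar>"
      using up lo e1 e2 e3 by linarith
    also have "\<dots> < e * \<bar>t\<bar>" using e elim(1) by simp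
    finally have "\<bar>ln (?s t) - ln ?r - t * f v0\<bar> / \<bar>t\<bar> < e" using elim(1) by (simp add: pos_divide_less_eq)
    moreover have "(ln (?s t) - ln ?r) / t - f v0 = (ln (?s t) - ln ?r - t * f v0) / t"
      using elim(1) by (simp add: field_simps)
    ultimately show ?case by (simp add: dist_real_def v0_def[symmetric] abs_divide)
  qed
qed

section \<open>Difference quotients of powers and dominated convergence\<close>

lemma tendsto_powr_diff_quotient:
  fixes s :: "real \<Rightarrow> real"
  assumes r: "r > 0" and s: "\<forall>\<^sub>F t in at 0. s t > 0"
    and lim: "((\<lambda>t. (ln (s t) - ln r) / t) \<longlongrightarrow> d) (at 0)"
  shows "((\<lambda>t. (s t powr q - r powr q) / t) \<longlongrightarrow> q * r powr q * d) (at 0)"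
proof -
  \<comment> \<open>The limit says nothing about \<open>s 0\<close>, so the value at
    \<open>0\<close> is set to \<open>ln r\<close>; the hypothesis then becomes a derivative of
    \<open>L\<close> and the chain rule applies.\<close>
  define L where "L t = (if t = 0 then ln r else ln (s t))" for t
  have L0: "L 0 = ln r" by (simp add: L_def)
  have "((\<lambda>t. (L (0 + t) - L 0) / t) \<longlongrightarrow> d) (at 0)"
    using lim by (rule Lim_transform_eventually) (auto simp: L_def eventually_at_filter)
  then have "DERIV L 0 :> d" by (simp add: DERIV_def)
  then have "DERIV (\<lambda>t. exp (q * L t)) 0 :> q * r powr q * d"
    using r L0 by (auto intro!: derivative_eq_intros simp: powr_def)
  then have "((\<lambda>t. (exp (q * L (0 + t)) - exp (q * L 0)) / t) \<longlongrightarrow> q * r powr q * d) (at 0)"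
    by (simp add: DERIV_def)
  moreover have "\<forall>\<^sub>F t in at 0. t \<noteq> (0::real)" by (simp add: eventually_at_filter)
  with s have "\<forall>\<^sub>F t in at 0. (exp (q * L (0 + t)) - exp (q * L 0)) / t = (s t powr q - r powr q) / t"
    by eventually_elim (use r in \<open>simp add: L_def powr_def\<close>)
  ultimately show ?thesis by (rule Lim_transform_eventually)
qed

lemma abs_exp_minus_one_le: "\<bar>exp y - 1\<bar> \<le> \<bar>y\<bar> * exp \<bar>y\<bar>" for y :: real
proof -
  have "exp y * (1 - y) \<le> exp y * exp (- y)"
    using exp_ge_add_one_self[of "- y"] by (intro mult_left_mono) auto
  then have 1: "exp y - 1 \<le> y * exp y" by (simp add: algebra_simps flip: exp_add)
  have 2: "1 - exp y \<le> - y" using exp_ge_add_one_self[of y] by linarith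
  have 3: "- y \<le> \<bar>y\<bar> * exp \<bar>y\<bar>"
    using mult_left_mono[of 1 "exp \<bar>y\<bar>" "\<bar>y\<bar>"] by simp
  have 4: "y * exp y \<le> \<bar>y\<bar> * exp \<bar>y\<bar>" by (intro mult_mono) auto
  show ?thesis using 1 2 3 4 by linarith
qed

text \<open>With \<open>c\<close> proportional to \<open>\<bar>t\<bar>\<close> the bound is linear
  in \<open>\<bar>t\<bar>\<close> up to a bounded factor, as domination of the difference quotients
  requires.\<close>

lemma powr_diff_bound:
  fixes r s :: real
  assumes "r > 0" "s > 0" "\<bar>ln s - ln r\<bar> \<le> c"
  shows "\<bar>s powr q - r powr q\<bar> \<le> r powr q * (\<bar>q\<bar> * c * exp (\<bar>q\<bar> * c))"
proof -
  define y where "y = q * (ln s - ln r)"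
  have y: "\<bar>y\<bar> \<le> \<bar>q\<bar> * c" unfolding y_def abs_mult using assms(3) by (intro mult_left_mono) auto
  have "s powr q - r powr q = r powr q * (exp y - 1)"
    using assms(1,2) by (simp add: powr_def y_def algebra_simps flip: exp_add)
  then have "\<bar>s powr q - r powr q\<bar> = r powr q * \<bar>exp y - 1\<bar>" by (simp add: abs_mult)
  also have "\<dots> \<le> r powr q * (\<bar>y\<bar> * exp \<bar>y\<bar>)" by (intro mult_left_mono abs_exp_minus_one_le) auto
  also have "\<dots> \<le> r powr q * (\<bar>q\<bar> * c * exp (\<bar>q\<bar> * c))"
    using y by (intro mult_left_mono mult_mono) auto
  finally show ?thesis .
qed

text \<open>Reduction to sequences tending to \<open>a\<close>. The hypotheses hold only for
  parameters near \<open>a\<close>, so each sequence is shifted by an \<open>N\<close> past which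
  they apply.\<close>

lemma tendsto_integral_at_dominated:
  fixes s :: "real \<Rightarrow> 'a \<Rightarrow> real"
  assumes meas: "\<forall>\<^sub>F t in at a. s t \<in> borel_measurable M" and g: "g \<in> borel_measurable M"
    and w: "integrable M w"
    and lim: "AE x in M. ((\<lambda>t. s t x) \<longlongrightarrow> g x) (at a)"
    and bound: "\<forall>\<^sub>F t in at a. AE x in M. norm (s t x) \<le> w x"
  shows "((\<lambda>t. integral\<^sup>L M (s t)) \<longlongrightarrow> integral\<^sup>L M g) (at a)"
  unfolding tendsto_at_iff_sequentially comp_def
proof (intro allI impI)
  fix X :: "nat \<Rightarrow> real" assume X: "\<forall>i. X i \<in> UNIV - {a}" "X \<longlonglongrightarrow> a"
  then have XF: "filterlim X (at a) sequentially" by (simp add: filterlim_at)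
  have "\<forall>\<^sub>F n in sequentially. s (X n) \<in> borel_measurable M \<and> (AE x in M. norm (s (X n) x) \<le> w x)"
    using eventually_compose_filterlim[OF eventually_conj[OF meas bound] XF] .
  then obtain N where N: "\<And>n. n \<ge> N \<Longrightarrow> s (X n) \<in> borel_measurable M \<and> (AE x in M. norm (s (X n) x) \<le> w x)"
    by (auto simp: eventually_sequentially)
  have "(\<lambda>n. integral\<^sup>L M (s (X (n + N)))) \<longlonglongrightarrow> integral\<^sup>L M g"
  proof (rule integral_dominated_convergence[OF g _ w])
    show "AE x in M. (\<lambda>n. s (X (n + N)) x) \<longlonglongrightarrow> g x"
      using lim
    proof eventually_elim
      case (elim x)
      show ?case by (rule LIMSEQ_ignore_initial_segment[OF filterlim_compose[OF elim XF]])
    qed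
  qed (use N in auto)
  then show "(\<lambda>n. integral\<^sup>L M (s (X n))) \<longlonglongrightarrow> integral\<^sup>L M g" by (rule LIMSEQ_offset)
qed

section \<open>The variational formula\<close>

theorem theorem4p3:
  fixes M Q :: "'a::euclidean_space set"
    and f :: "'a \<Rightarrow> real"
    and h :: "real \<Rightarrow> 'a \<Rightarrow> real"
    and o_fun :: "real \<Rightarrow> 'a \<Rightarrow> real"
    and \<delta> q j :: real
  assumes M: "convex_body_o M"
    and f_cont: "continuous_on (sphere 0 1) f"
    and Q: "star_body_o Q"
    and j: "j \<noteq> real DIM('a)"
    and q: "q \<noteq> 0"
    and \<delta>: "\<delta> > 0"
    and h_cont: "\<And>t. \<bar>t\<bar> < \<delta> \<Longrightarrow> continuous_on (sphere 0 1) (h t)"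
    and h_pos: "\<And>t v. \<bar>t\<bar> < \<delta> \<Longrightarrow> v \<in> sphere 0 1 \<Longrightarrow> h t v > 0"
    and h_log: "\<And>t v. \<bar>t\<bar> < \<delta> \<Longrightarrow> v \<in> sphere 0 1 \<Longrightarrow>
                  ln (h t v) = ln (support_fun M v) + t * f v + o_fun t v"
    and o_cont: "\<And>t. \<bar>t\<bar> < \<delta> \<Longrightarrow> continuous_on (sphere 0 1) (o_fun t)"
    and o_small: "\<And>\<epsilon>. \<epsilon> > 0 \<Longrightarrow> \<exists>\<eta>>0. \<forall>t. 0 < \<bar>t\<bar> \<and> \<bar>t\<bar> < \<eta> \<longrightarrow>
                    (\<forall>v\<in>sphere 0 1. \<bar>o_fun t v / t\<bar> < \<epsilon>)"
  shows "((\<lambda>t. (dual_W q j (wulff_shape (h t)) Q - dual_W q j M Q) / t)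
           \<longlongrightarrow> q * (\<integral>v. f v \<partial>dual_curv_measure q j M Q)) (at 0)"
proof -
  let ?S = "sphere (0::'a) 1" and ?h = "support_fun M" and ?n = "real DIM('a)"
  let ?\<sigma> = "sphere_measure :: 'a measure"
  interpret finite_measure ?\<sigma> by (rule finite_sphere_measure)
  have h0: "continuous_on ?S ?h" "\<forall>v\<in>?S. ?h v > 0"
    using continuous_on_support_fun[OF M] support_fun_pos[OF M] by blast+
  have W: "wulff_shape ?h = M" by (rule wulff_shape_support_fun[OF M])
  have near: "\<forall>\<^sub>F t in at 0. \<bar>t\<bar> < c" if "c > 0" for c :: real
    using that unfolding eventually_at by (intro exI[of _ c]) (auto simp: dist_real_def)
  have nz: "\<forall>\<^sub>F t in at 0. t \<noteq> (0::real)" by (simp add: eventually_at_filter)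
  have hk: "\<forall>\<^sub>F t in at 0. continuous_on ?S (h t) \<and> (\<forall>v\<in>?S. h t v > 0)"
    using near[OF \<delta>] by eventually_elim (use h_cont h_pos in blast)
  have unif: "\<forall>\<^sub>F t in at 0. \<forall>v\<in>?S. \<bar>ln (h t v) - ln (?h v) - t * f v\<bar> \<le> \<epsilon> * \<bar>t\<bar>"
    if \<epsilon>: "\<epsilon> > 0" for \<epsilon>
  proof -
    obtain \<eta> where \<eta>: "\<eta> > 0" "\<And>t v. 0 < \<bar>t\<bar> \<Longrightarrow> \<bar>t\<bar> < \<eta> \<Longrightarrow> v \<in> ?S \<Longrightarrow> \<bar>o_fun t v / t\<bar> < \<epsilon>"
      using o_small[OF \<epsilon>] by blast
    show ?thesis using near[OF \<delta>] near[OF \<eta>(1)] nz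
    proof eventually_elim
      case (elim t)
      show ?case
      proof
        fix v assume v: "v \<in> ?S"
        have "\<bar>o_fun t v\<bar> / \<bar>t\<bar> < \<epsilon>" using \<eta>(2)[of t v] elim v by (simp add: abs_divide)
        then have "\<bar>o_fun t v\<bar> \<le> \<epsilon> * \<bar>t\<bar>" using elim by (simp add: pos_divide_less_eq)
        then show "\<bar>ln (h t v) - ln (?h v) - t * f v\<bar> \<le> \<epsilon> * \<bar>t\<bar>"
          using h_log[OF elim(1) v] by simp
      qed
    qed
  qed
  have bounded_on: "\<exists>B>0. \<forall>u\<in>?S. \<bar>g u\<bar> \<le> B" if "continuous_on ?S g" for g :: "'a \<Rightarrow> real"
    using compact_imp_bounded[OF compact_continuous_image[OF that compact_sphere]]
    by (auto simp: bounded_pos)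
  obtain F where F: "F > 0" "\<And>v. v \<in> ?S \<Longrightarrow> \<bar>f v\<bar> \<le> F" using bounded_on[OF f_cont] by blast
  \<comment> \<open>\<open>F\<close> bounds the linear term \<open>f\<close>, and the
    \<open>1\<close> absorbs the remainder, estimated with \<open>\<epsilon> = 1\<close>.\<close>
  define C where "C = F + 1"
  have C: "C > 0" using F by (simp add: C_def)
  have lip: "\<forall>\<^sub>F t in at 0. \<forall>v\<in>?S. \<bar>ln (h t v) - ln (?h v)\<bar> \<le> C * \<bar>t\<bar>"
    using unif[OF zero_less_one]
  proof eventually_elim
    case (elim t)
    show ?case
    proof
      fix v assume v: "v \<in> ?S"
      have "\<bar>t * f v\<bar> \<le> F * \<bar>t\<bar>" using mult_left_mono[OF F(2)[OF v], of "\<bar>t\<bar>"] by (simp add: abs_mult mult.commute)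
      moreover have "\<bar>ln (h t v) - ln (?h v) - t * f v\<bar> \<le> \<bar>t\<bar>" using elim v by simp
      ultimately show "\<bar>ln (h t v) - ln (?h v)\<bar> \<le> C * \<bar>t\<bar>"
        unfolding C_def distrib_right by linarith
    qed
  qed
  define k where "k u = radial_fun Q u powr (?n - q - j)" for u
  have k_cont: "continuous_on ?S k" unfolding k_def
    using Q by (intro continuous_intros) (auto simp: star_body_o_def less_le)
  have r_cont: "continuous_on ?S (\<lambda>u. radial_fun (wulff_shape p) u powr q)"
    if "continuous_on ?S p" "\<forall>v\<in>?S. p v > 0" for p :: "'a \<Rightarrow> real"
    using continuous_on_wulff_radial[OF that] wulff_radial(1)[OF that]
    by (intro continuous_intros) (auto simp: less_le)
  have meas: "g \<in> borel_measurable ?\<sigma>" if "continuous_on ?S g" for g :: "'a \<Rightarrow> real"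
    using borel_measurable_continuous_on_restrict[OF that] by (simp cong: measurable_cong_sets)
  have int: "integrable ?\<sigma> g" if g: "continuous_on ?S g" for g :: "'a \<Rightarrow> real"
  proof -
    obtain B where "\<forall>u\<in>?S. \<bar>g u\<bar> \<le> B" using bounded_on[OF g] by blast
    then show ?thesis by (intro integrable_const_bound[of _ B] meas g) auto
  qed
  \<comment> \<open>Up to the factor \<open>1 / ?n\<close>, \<open>s t\<close> is the integrand of
    the difference quotient and \<open>g\<close> is its limit at regular directions.\<close>
  define s where "s t u = (radial_fun (wulff_shape (h t)) u powr q - radial_fun M u powr q) / t * k u" for t u
  define g where "g u = q * radial_fun M u powr q * f (radial_gauss_map ?h u) * k u" for u
  have rk_cont: "continuous_on ?S (\<lambda>u. radial_fun M u powr q)" using r_cont[OF h0] by (simp add: W)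
  obtain B where B: "B > 0" "\<forall>u\<in>?S. \<bar>radial_fun M u powr q * k u\<bar> \<le> B"
    using bounded_on[OF continuous_on_mult[OF rk_cont k_cont]] by blast
  have gm: "radial_gauss_map ?h \<in> ?\<sigma> \<rightarrow>\<^sub>M restrict_space borel ?S"
    using radial_gauss_map_measurable[OF h0] by (simp cong: measurable_cong_sets)
  have fg: "(\<lambda>u. f (radial_gauss_map ?h u)) \<in> borel_measurable ?\<sigma>"
    by (rule measurable_compose[OF gm borel_measurable_continuous_on_restrict[OF f_cont]])
  have "((\<lambda>t. integral\<^sup>L ?\<sigma> (s t)) \<longlongrightarrow> integral\<^sup>L ?\<sigma> g) (at 0)"
  proof (rule tendsto_integral_at_dominated)
    show "\<forall>\<^sub>F t in at 0. s t \<in> borel_measurable ?\<sigma>"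
      using hk unfolding s_def
      by eventually_elim (intro borel_measurable_times borel_measurable_divide borel_measurable_diff
          borel_measurable_const meas r_cont rk_cont k_cont; simp)
    show "g \<in> borel_measurable ?\<sigma>" unfolding g_def
      by (intro borel_measurable_times borel_measurable_const meas rk_cont k_cont fg)
    show "integrable ?\<sigma> (\<lambda>_. B * (\<bar>q\<bar> * C * exp (\<bar>q\<bar> * C)))" by simp
    show "AE u in ?\<sigma>. ((\<lambda>t. s t u) \<longlongrightarrow> g u) (at 0)"
      using AE_sphere_measure_regular[OF h0]
    proof eventually_elim
      case (elim u)
      then have u: "u \<in> ?S" by (simp add: regular_dirs_def)
      have pos: "\<forall>\<^sub>F t in at 0. radial_fun (wulff_shape (h t)) u > 0"
        using hk by eventually_elim (use wulff_radial(1) u in blast)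
      have "((\<lambda>t. (ln (radial_fun (wulff_shape (h t)) u) - ln (radial_fun M u)) / t)
           \<longlongrightarrow> f (radial_gauss_map ?h u)) (at 0)"
        using tendsto_ln_wulff_radial[OF h0 hk f_cont lip unif elim] by (simp add: W)
      then have "((\<lambda>t. (radial_fun (wulff_shape (h t)) u powr q - radial_fun M u powr q) / t)
           \<longlongrightarrow> q * radial_fun M u powr q * f (radial_gauss_map ?h u)) (at 0)"
        using wulff_radial(1)[OF h0 u] pos by (intro tendsto_powr_diff_quotient) (simp_all add: W)
      then show ?case unfolding s_def g_def by (intro tendsto_intros)
    qed
    show "\<forall>\<^sub>F t in at 0. AE u in ?\<sigma>. norm (s t u) \<le> B * (\<bar>q\<bar> * C * exp (\<bar>q\<bar> * C))"
      using hk lip nz near[OF zero_less_one]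
    proof eventually_elim
      case (elim t)
      show ?case
      proof (rule AE_I2)
        fix u assume "u \<in> space ?\<sigma>"
        then have u: "u \<in> ?S" by simp
        let ?r = "radial_fun M u" and ?s = "radial_fun (wulff_shape (h t)) u"
        have ht: "continuous_on ?S (h t)" "\<forall>v\<in>?S. h t v > 0" using elim by auto
        have rs: "?r > 0" "?s > 0" using wulff_radial(1)[OF h0 u] wulff_radial(1)[OF ht u] by (simp_all add: W)
        have "\<bar>ln ?s - ln ?r\<bar> \<le> C * \<bar>t\<bar>"
          using ln_wulff_radial_diff_bound[OF h0 ht u elim(2)] by (simp add: W)
        then have "\<bar>?s powr q - ?r powr q\<bar> \<le> ?r powr q * (\<bar>q\<bar> * (C * \<bar>t\<bar>) * exp (\<bar>q\<bar> * (C * \<bar>t\<bar>)))"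
          by (rule powr_diff_bound[OF rs])
        \<comment> \<open>Only the \<open>\<bar>t\<bar>\<close> in the exponent is estimated by
          \<open>1\<close>; the linear factor is kept to cancel the division by
          \<open>\<bar>t\<bar>\<close>.\<close>
        also have "\<dots> \<le> ?r powr q * (\<bar>q\<bar> * (C * \<bar>t\<bar>) * exp (\<bar>q\<bar> * C))"
        proof -
          have "C * \<bar>t\<bar> \<le> C" using C elim(4) by (simp add: mult_le_cancel_left2)
          then have "\<bar>q\<bar> * (C * \<bar>t\<bar>) \<le> \<bar>q\<bar> * C" by (rule mult_left_mono) simp
          then show ?thesis using C by (intro mult_left_mono) simp_all
        qed
        finally have "\<bar>?s powr q - ?r powr q\<bar> / \<bar>t\<bar> \<le> ?r powr q * (\<bar>q\<bar> * C * exp (\<bar>q\<bar> * C))"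
          using elim(3) by (simp add: pos_divide_le_eq mult_ac)
        then have "\<bar>?s powr q - ?r powr q\<bar> / \<bar>t\<bar> * \<bar>k u\<bar>
            \<le> ?r powr q * (\<bar>q\<bar> * C * exp (\<bar>q\<bar> * C)) * \<bar>k u\<bar>"
          by (rule mult_right_mono) simp
        also have "\<dots> = \<bar>?r powr q * k u\<bar> * (\<bar>q\<bar> * C * exp (\<bar>q\<bar> * C))" by (simp add: abs_mult)
        also have "\<dots> \<le> B * (\<bar>q\<bar> * C * exp (\<bar>q\<bar> * C))"
          using B u C by (intro mult_right_mono) auto
        finally show "norm (s t u) \<le> B * (\<bar>q\<bar> * C * exp (\<bar>q\<bar> * C))"
          by (simp add: s_def abs_mult abs_divide)
      qed
    qed
  qed
  then have lim: "((\<lambda>t. 1 / ?n * integral\<^sup>L ?\<sigma> (s t)) \<longlongrightarrow> 1 / ?n * integral\<^sup>L ?\<sigma> g) (at 0)"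
    by (intro tendsto_mult tendsto_const)
  have "\<forall>\<^sub>F t in at 0. 1 / ?n * integral\<^sup>L ?\<sigma> (s t) = (dual_W q j (wulff_shape (h t)) Q - dual_W q j M Q) / t"
    using hk
  proof eventually_elim
    case (elim t)
    let ?A = "\<lambda>u. radial_fun (wulff_shape (h t)) u powr q * k u" and ?B = "\<lambda>u. radial_fun M u powr q * k u"
    have "integral\<^sup>L ?\<sigma> (s t) = (\<integral>u. (?A u - ?B u) / t \<partial>?\<sigma>)"
      by (intro Bochner_Integration.integral_cong) (simp_all add: s_def left_diff_distrib)
    also have "\<dots> = (\<integral>u. ?A u - ?B u \<partial>?\<sigma>) / t" by simp
    also have "(\<integral>u. ?A u - ?B u \<partial>?\<sigma>) = integral\<^sup>L ?\<sigma> ?A - integral\<^sup>L ?\<sigma> ?B"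
      using elim by (intro Bochner_Integration.integral_diff int continuous_on_mult r_cont rk_cont k_cont) auto
    finally show ?case by (simp add: dual_W_def k_def diff_divide_distrib mult.commute)
  qed
  moreover have "1 / ?n * integral\<^sup>L ?\<sigma> g = q * (\<integral>v. f v \<partial>dual_curv_measure q j M Q)"
  proof -
    let ?w = "\<lambda>u. 1 / ?n * radial_fun M u powr q * radial_fun Q u powr (?n - q - j)"
    \<comment> \<open>Change of variables along the radial Gauss map, after which the density is
      moved into the integrand and matches \<open>g\<close>.\<close>
    have "(\<integral>v. f v \<partial>dual_curv_measure q j M Q)
        = (\<integral>u. f (radial_gauss_map ?h u) \<partial>density ?\<sigma> (\<lambda>u. ennreal (?w u)))"
      unfolding dual_curv_measure_eq_distr(1)[OF M Q]
      using gm by (intro integral_distr borel_measurable_continuous_on_restrict f_cont) simp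
    also have "\<dots> = (\<integral>u. ?w u *\<^sub>R f (radial_gauss_map ?h u) \<partial>?\<sigma>)"
      by (intro integral_density fg dual_curv_measure_eq_distr(2)[OF M Q]) simp
    also have "q * \<dots> = (\<integral>u. 1 / ?n * g u \<partial>?\<sigma>)"
      by (subst integral_mult_right_zero[symmetric], intro Bochner_Integration.integral_cong)
         (simp_all add: g_def k_def)
    finally show ?thesis by simp
  qed
  ultimately show ?thesis using Lim_transform_eventually[OF lim] by simp
qed

end
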